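(* For every integer $d \ge 2$ and every $(p,q) \in [0.4950,\,0.4975]\times[0.9999998,\,1]$, the frog model with death $1-q$ and drift $p$ on the $d$-ary tree, $\mathrm{FM}(d,q,p)$, is recurrent with positive probability; that is, $\mathbf P(\mathrm{FM}(d,q,p)\text{ is recurrent})>0$.
   Context: Let $\mathbb T_d$ be the infinite rooted $d$-ary tree (every vertex, including the root, has exactly $d$ children). The frog model with death $1-q$ and drift $p$, denoted $\mathrm{FM}(d,q,p)$, is the following discrete-time process. Initially there is one active frog at the root and one sleeping frog at each non-root vertex. Before taking each step, each active frog independently dies (and is removed) with probability $1-q$; with probability $q$ it survives and jumps. A surviving active frog at a non-root vertex moves to the parent of its current vertex with probability $p$ and with probability $1-p$ moves to a uniformly chosen child of its current vertex. A surviving active frog at the root stays in place with probability $p$ and with probability $1-p$ moves to a uniformly chosen child of the root. All choices are independent across frogs and steps. Whenever an active frog visits a vertex containing a sleeping frog, that sleeping frog becomes active and from then on follows the same rules independently. A realization of the process is called recurrent if the root is visited by infinitely many active frogs, and transient otherwise. *)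

theory Defs
  imports "HOL-Probability.Probability"
begin

text \<open>
  A vertex of the rooted \<open>d\<close>-ary tree is the word of child labels leading to it, deepest label
  first: the root is \<open>[]\<close>, the children of \<open>x\<close> are \<open>c # x\<close> for \<open>c < d\<close>, and the parent of a
  non-root vertex \<open>x\<close> is \<open>tl x\<close>.
\<close>

type_synonym vertex = "nat list"

definition vertices :: "nat \<Rightarrow> vertex set" where
  "vertices d = {v. set v \<subseteq> {..<d}}"

datatype move = Die | Up | Down nat

definition move_pmf :: "nat \<Rightarrow> real \<Rightarrow> real \<Rightarrow> move pmf" where
  "move_pmf d q p =
     do { survives \<leftarrow> bernoulli_pmf q;
          if \<not> survives then return_pmf Die
          else do { up \<leftarrow> bernoulli_pmf p;
                    if up then return_pmf Up
                    else map_pmf Down (pmf_of_set {..<d}) } }"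

text \<open>\<open>Awake n x\<close>: the frog is active, located at \<open>x\<close>, and has made \<open>n\<close> jumps since waking up.\<close>

datatype frog = Asleep | Awake nat vertex | Dead

definition active_at :: "vertex \<Rightarrow> frog \<Rightarrow> bool" where
  "active_at x s \<longleftrightarrow> (\<exists>n. s = Awake n x)"

text \<open>
  A frog moves according to its own stream \<open>\<xi>\<close> of moves, read from the time of its waking.
  Since \<open>tl [] = []\<close>, the move \<open>Up\<close> leaves a frog at the root in place.
\<close>

fun advance :: "(nat \<Rightarrow> move) \<Rightarrow> frog \<Rightarrow> frog" where
  "advance \<xi> Asleep = Asleep"
| "advance \<xi> Dead = Dead"
| "advance \<xi> (Awake n x) =
     (case \<xi> n of
        Die \<Rightarrow> Dead
      | Up \<Rightarrow> Awake (Suc n) (tl x)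
      | Down c \<Rightarrow> Awake (Suc n) (c # x))"

text \<open>
  \<open>frog_state d \<omega> t v\<close> is the state at time \<open>t\<close> of the frog that starts at \<open>v\<close>; \<open>\<omega> (v, n)\<close> is the
  \<open>n\<close>-th entry of its stream of moves.
\<close>

primrec frog_state :: "nat \<Rightarrow> (vertex \<times> nat \<Rightarrow> move) \<Rightarrow> nat \<Rightarrow> vertex \<Rightarrow> frog" where
  "frog_state d \<omega> 0 = (\<lambda>v. if v = [] then Awake 0 [] else Asleep)"
| "frog_state d \<omega> (Suc t) =
     (let s = (\<lambda>v. advance (\<lambda>n. \<omega> (v, n)) (frog_state d \<omega> t v))
      in (\<lambda>v. if s v = Asleep \<and> (\<exists>u\<in>vertices d. active_at v (s u)) then Awake 0 v else s v))"

definition FM :: "nat \<Rightarrow> real \<Rightarrow> real \<Rightarrow> (vertex \<times> nat \<Rightarrow> move) measure" where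
  "FM d q p = (\<Pi>\<^sub>M i \<in> vertices d \<times> UNIV. measure_pmf (move_pmf d q p))"

text \<open>The count is of distinct frogs, not of visits.\<close>

definition recurrent :: "nat \<Rightarrow> (vertex \<times> nat \<Rightarrow> move) \<Rightarrow> bool" where
  "recurrent d \<omega> \<longleftrightarrow> infinite {v \<in> vertices d. \<exists>t. active_at [] (frog_state d \<omega> t v)}"

end

(*
A frog that visits a sleeping frog wakes it whatever the other frogs do, so it suffices to follow
chains of wakings. If F is a [0,1]-valued function on the tree that grows in mean by a fixed
factor in every step of the walk off w, then a walk from x ever visits w with probability at least
F(x). Applied to weights 0.95 per upward and 0.9/d per downward step of the tree path from x to w,
this bounds all visiting probabilities from below, uniformly in the depth.

Each vertex x passes wakings on to those grandchildren z, with y the vertex in between, for which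
the frog of x visits z, or the frog of x visits y and the frog of y visits z. Distinct grandchildren
root disjoint subtrees, so this is a branching process. With e = 0.9/d, its mean number of children
is at least d^2 e^2 (2 - e) > 1.25, and a frog two levels deeper returns to the root with a
probability smaller by a factor of about 0.95^2 = 0.9025. As 1.25 * 0.9025 > 1, the probability
that some frog of generation n visits the root stays bounded away from 0, and infinitely many
generations do so with positive probability.
*)

theory Submission
  imports Defs "HOL-Library.Sublist"
begin

section \<open>Wakings along the streams of single frogs\<close>

text \<open>The stream is shifted after each move, so that the first step of the walk can be split
  off. The starting position counts as a visit.\<close>

primrec reaches :: "vertex \<Rightarrow> nat \<Rightarrow> vertex \<Rightarrow> (nat \<Rightarrow> move) \<Rightarrow> bool" where
  "reaches w 0 x \<xi> \<longleftrightarrow> x = w"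
| "reaches w (Suc n) x \<xi> \<longleftrightarrow> x = w \<or>
     (case \<xi> 0 of
        Die \<Rightarrow> False
      | Up \<Rightarrow> reaches w n (tl x) (\<lambda>i. \<xi> (Suc i))
      | Down c \<Rightarrow> reaches w n (c # x) (\<lambda>i. \<xi> (Suc i)))"

text \<open>The stream of \<open>u\<close> alone decides this, whether or not its frog is ever
  woken; this is the source of independence.\<close>

definition visits :: "vertex \<Rightarrow> vertex \<Rightarrow> (vertex \<times> nat \<Rightarrow> move) \<Rightarrow> bool" where
  "visits u w \<omega> \<longleftrightarrow> (\<exists>n. reaches w n u (\<lambda>i. \<omega> (u, i)))"

text \<open>\<open>Awake 0 v\<close> marks the moment of waking, from which the stream of
  \<open>v\<close> is read at index 0.\<close>

definition woken :: "nat \<Rightarrow> (vertex \<times> nat \<Rightarrow> move) \<Rightarrow> vertex \<Rightarrow> bool" where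
  "woken d \<omega> v \<longleftrightarrow> (\<exists>t. frog_state d \<omega> t v = Awake 0 v)"

lemma woken_root: "woken d \<omega> []"
  by (auto simp: woken_def intro: exI[of _ 0])

lemma woken_if_not_Asleep:
  assumes "frog_state d \<omega> t v \<noteq> Asleep"
  shows "woken d \<omega> v"
  using assms
proof (induction t)
  case 0
  then show ?case by (auto simp: woken_root split: if_splits)
next
  case (Suc t)
  show ?case
  proof (cases "frog_state d \<omega> t v = Asleep")
    case True
    with Suc.prems have "frog_state d \<omega> (Suc t) v = Awake 0 v"
      by (auto simp: Let_def split: if_splits)
    then show ?thesis unfolding woken_def by blast
  qed (use Suc.IH in blast)
qed

text \<open>After time 0, a frog at \<open>v\<close> either has just woken there, so that
  \<open>v = u\<close>, or has moved there and wakes the frog of \<open>v\<close> if that one is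
  still asleep.\<close>

lemma woken_if_active:
  assumes "active_at v (frog_state d \<omega> t u)" "u \<in> vertices d"
  shows "woken d \<omega> v"
proof (cases t)
  case 0
  with assms show ?thesis by (auto simp: active_at_def woken_root split: if_splits)
next
  case (Suc t')
  let ?s = "\<lambda>v. advance (\<lambda>n. \<omega> (v, n)) (frog_state d \<omega> t' v)"
  show ?thesis
  proof (cases "?s u = Asleep")
    case True
    with assms Suc have "v = u"
      by (auto simp: active_at_def Let_def split: if_splits)
    with assms(1) woken_if_not_Asleep[of d \<omega> t u] show ?thesis
      by (auto simp: active_at_def)
  next
    case False
    with assms Suc have act: "active_at v (?s u)"
      by (auto simp: Let_def)
    have "frog_state d \<omega> (Suc t') v \<noteq> Asleep"
    proof (cases "?s v = Asleep")
      case True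
      with act assms(2) have "frog_state d \<omega> (Suc t') v = Awake 0 v"
        by (auto simp: Let_def)
      then show ?thesis by simp
    qed (auto simp: Let_def)
    then show ?thesis by (rule woken_if_not_Asleep)
  qed
qed

text \<open>The offset \<open>k\<close> carries the induction: after one move the counter in the
  state is \<open>Suc k\<close> and the rest of the stream is read.\<close>

lemma reaches_active:
  assumes "reaches w n x (\<lambda>i. \<omega> (u, k + i))" "frog_state d \<omega> t u = Awake k x"
  shows "\<exists>t'. active_at w (frog_state d \<omega> t' u)"
  using assms
proof (induction n arbitrary: k x t)
  case 0
  then show ?case by (auto simp: active_at_def)
next
  case (Suc n)
  show ?case
  proof (cases "x = w")
    case True
    with Suc.prems show ?thesis by (auto simp: active_at_def)
  next
    case False
    have shift: "(\<lambda>i. \<omega> (u, k + Suc i)) = (\<lambda>i. \<omega> (u, Suc k + i))" by simp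
    show ?thesis
    proof (cases "\<omega> (u, k)")
      case Die
      with False Suc.prems show ?thesis by simp
    next
      case Up
      with False Suc.prems have "reaches w n (tl x) (\<lambda>i. \<omega> (u, Suc k + i))"
        by (simp add: shift)
      moreover from Up Suc.prems have "frog_state d \<omega> (Suc t) u = Awake (Suc k) (tl x)"
        by (simp add: Let_def)
      ultimately show ?thesis by (rule Suc.IH)
    next
      case (Down c)
      with False Suc.prems have "reaches w n (c # x) (\<lambda>i. \<omega> (u, Suc k + i))"
        by (simp add: shift)
      moreover from Down Suc.prems have "frog_state d \<omega> (Suc t) u = Awake (Suc k) (c # x)"
        by (simp add: Let_def)
      ultimately show ?thesis by (rule Suc.IH)
    qed
  qed
qed

lemma visits_active:
  assumes "woken d \<omega> u" "visits u w \<omega>"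
  shows "\<exists>t. active_at w (frog_state d \<omega> t u)"
  using assms reaches_active[of w _ u \<omega> u 0] by (auto simp: woken_def visits_def)

lemma woken_visits:
  assumes "woken d \<omega> u" "u \<in> vertices d" "visits u w \<omega>"
  shows "woken d \<omega> w"
  using visits_active[OF assms(1,3)] woken_if_active[OF _ assms(2)] by (elim exE)

text \<open>Generation \<open>n\<close> of the branching process from \<open>x\<close> has a member
  whose frog visits the root. This is a condition on streams only, so it makes sense whether or not
  \<open>x\<close> is woken.\<close>

primrec returns :: "nat \<Rightarrow> nat \<Rightarrow> vertex \<Rightarrow> (vertex \<times> nat \<Rightarrow> move) \<Rightarrow> bool" where
  "returns d 0 x \<omega> \<longleftrightarrow> visits x [] \<omega>"
| "returns d (Suc n) x \<omega> \<longleftrightarrow> (\<exists>(a, b)\<in>{..<d} \<times> {..<d}.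
     (visits x (b # a # x) \<omega> \<or> visits x (a # x) \<omega> \<and> visits (a # x) (b # a # x) \<omega>)
     \<and> returns d n (b # a # x) \<omega>)"

lemma Cons_in_vertices: "c # x \<in> vertices d \<longleftrightarrow> c < d \<and> x \<in> vertices d"
  by (auto simp: vertices_def)

lemma returns_active:
  assumes "returns d n x \<omega>" "woken d \<omega> x" "x \<in> vertices d"
  shows "\<exists>y\<in>vertices d. length y = length x + 2 * n \<and> (\<exists>t. active_at [] (frog_state d \<omega> t y))"
  using assms
proof (induction n arbitrary: x)
  case 0
  then show ?case using visits_active[of d \<omega> x "[]"] by auto
next
  case (Suc n)
  then obtain a b where ab: "a < d" "b < d" and
    e: "visits x (b # a # x) \<omega> \<or> visits x (a # x) \<omega> \<and> visits (a # x) (b # a # x) \<omega>" and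
    r: "returns d n (b # a # x) \<omega>"
    by auto
  have V: "a # x \<in> vertices d" "b # a # x \<in> vertices d"
    using ab Suc.prems by (auto simp: Cons_in_vertices)
  have "woken d \<omega> (b # a # x)"
    using e woken_visits Suc.prems V by blast
  from Suc.IH[OF r this V(2)] show ?case by auto
qed

text \<open>Generation \<open>n\<close> lies at depth \<open>2 * n\<close>, so different
  \<open>n\<close> give different frogs.\<close>

lemma recurrent_if_infinitely_many_returns:
  assumes "\<exists>\<^sub>\<infinity>n. returns d n [] \<omega>"
  shows "recurrent d \<omega>"
  unfolding recurrent_def
proof
  let ?R = "{v \<in> vertices d. \<exists>t. active_at [] (frog_state d \<omega> t v)}"
  assume "finite ?R"
  then have "finite ((\<lambda>v. length v div 2) ` ?R)" by simp
  moreover have "{n. returns d n [] \<omega>} \<subseteq> (\<lambda>v. length v div 2) ` ?R"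
  proof
    fix n assume "n \<in> {n. returns d n [] \<omega>}"
    then have "returns d n [] \<omega>" by simp
    from returns_active[OF this woken_root]
    obtain y where y: "y \<in> ?R" "length y = 2 * n" by (auto simp: vertices_def)
    then show "n \<in> (\<lambda>v. length v div 2) ` ?R"
      by (intro image_eqI[of _ _ y]) auto
  qed
  ultimately show False
    using assms finite_subset by (auto simp: INFM_iff_infinite)
qed

section \<open>Events determined by the streams of a set of vertices\<close>

text \<open>One property serves two purposes: measurability in \<open>FM d q p\<close> when
  \<open>K\<close> consists of vertices, and independence of events with disjoint
  \<open>K\<close>.\<close>

definition coordinate_event :: "vertex set \<Rightarrow> ((vertex \<times> nat \<Rightarrow> move) \<Rightarrow> bool) \<Rightarrow> bool" where
  "coordinate_event K P \<longleftrightarrow>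
     Measurable.pred (\<Pi>\<^sub>M i\<in>K \<times> UNIV. count_space UNIV) P \<and> (\<forall>\<omega>. P (restrict \<omega> (K \<times> UNIV)) = P \<omega>)"

lemma coordinate_event_mono:
  assumes "coordinate_event K P" "K \<subseteq> L"
  shows "coordinate_event L P"
proof -
  have sub: "K \<times> UNIV \<subseteq> L \<times> (UNIV::nat set)" using assms(2) by auto
  have P: "P (restrict \<omega> (K \<times> UNIV)) = P \<omega>" for \<omega>
    using assms(1) by (simp add: coordinate_event_def)
  have "P (restrict \<omega> (L \<times> UNIV)) = P \<omega>" for \<omega>
    using P[of \<omega>] P[of "restrict \<omega> (L \<times> UNIV)"] sub by (simp add: restrict_restrict Int_absorb1)
  moreover have "Measurable.pred (\<Pi>\<^sub>M i\<in>L \<times> UNIV. count_space UNIV) (\<lambda>\<omega>. P (restrict \<omega> (K \<times> UNIV)))"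
    by (rule measurable_compose[OF measurable_restrict_subset[OF sub]])
       (use assms(1) in \<open>simp add: coordinate_event_def\<close>)
  ultimately show ?thesis
    by (simp add: coordinate_event_def P)
qed

lemma coordinate_event_conj:
  "coordinate_event K P \<Longrightarrow> coordinate_event K Q \<Longrightarrow> coordinate_event K (\<lambda>\<omega>. P \<omega> \<and> Q \<omega>)"
  and coordinate_event_disj:
  "coordinate_event K P \<Longrightarrow> coordinate_event K Q \<Longrightarrow> coordinate_event K (\<lambda>\<omega>. P \<omega> \<or> Q \<omega>)"
  by (auto simp: coordinate_event_def)

lemma coordinate_event_bex:
  assumes "countable I" "\<And>i. i \<in> I \<Longrightarrow> coordinate_event K (P i)"
  shows "coordinate_event K (\<lambda>\<omega>. \<exists>i\<in>I. P i \<omega>)"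
  using assms by (auto simp: coordinate_event_def intro!: measurable_pred_countable)

lemma measurable_reaches:
  assumes u: "u \<in> K"
  shows "Measurable.pred (\<Pi>\<^sub>M i\<in>K \<times> UNIV. count_space UNIV) (\<lambda>\<omega>. reaches w n x (\<lambda>i. \<omega> (u, k + i)))"
proof (induction n arbitrary: k x)
  case (Suc n)
  let ?M = "\<Pi>\<^sub>M i\<in>K \<times> (UNIV::nat set). count_space UNIV"
  have [measurable]: "(\<lambda>\<omega>. \<omega> (u, j)) \<in> measurable ?M (count_space UNIV)" for j
    using u by (intro measurable_component_singleton) auto
  have [measurable]: "Measurable.pred ?M (\<lambda>\<omega>. reaches w n y (\<lambda>i. \<omega> (u, Suc (k + i))))" for y
    using Suc[of "y" "Suc k"] by simp
  have "reaches w (Suc n) x (\<lambda>i. \<omega> (u, k + i)) \<longleftrightarrow> x = w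
      \<or> \<omega> (u, k) = Up \<and> reaches w n (tl x) (\<lambda>i. \<omega> (u, Suc (k + i)))
      \<or> (\<exists>c. \<omega> (u, k) = Down c \<and> reaches w n (c # x) (\<lambda>i. \<omega> (u, Suc (k + i))))" for \<omega>
    by (cases "\<omega> (u, k)") auto
  then show ?case by simp
qed simp

lemma coordinate_event_visits:
  assumes "u \<in> K"
  shows "coordinate_event K (visits u w)"
proof -
  have "Measurable.pred (\<Pi>\<^sub>M i\<in>K \<times> UNIV. count_space UNIV)
      (\<lambda>\<omega>. \<exists>n. reaches w n u (\<lambda>i. \<omega> (u, 0 + i)))"
    using measurable_reaches[OF assms, of w _ u 0] by measurable
  then show ?thesis
    using assms by (simp add: coordinate_event_def visits_def[abs_def])
qed

text \<open>Every stream that is read belongs to \<open>x\<close> or to a descendant of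
  \<open>x\<close>; hence returns from disjoint subtrees will be independent.\<close>

lemma coordinate_event_returns:
  assumes "x \<in> vertices d"
  shows "coordinate_event {v \<in> vertices d. suffix x v} (returns d n x)"
  using assms
proof (induction n arbitrary: x)
  case 0
  have "returns d 0 x = visits x []" by auto
  with 0 show ?case by (simp add: coordinate_event_visits)
next
  case (Suc n)
  let ?T = "\<lambda>x. {v \<in> vertices d. suffix x v}"
  have sub: "?T (b # a # x) \<subseteq> ?T x" for a b
    by (auto simp: suffix_def)
  have "coordinate_event (?T x) (returns d n (b # a # x))" if "a < d" "b < d" for a b
    using that Suc.prems by (intro coordinate_event_mono[OF Suc.IH sub]) (simp add: Cons_in_vertices)
  moreover have "a # x \<in> ?T x" "x \<in> ?T x" if "a < d" for a
    using that Suc.prems by (auto simp: suffix_def Cons_in_vertices)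
  ultimately show ?case
    unfolding returns.simps case_prod_unfold
    by (intro coordinate_event_bex coordinate_event_conj coordinate_event_disj
        coordinate_event_visits) auto
qed

lemma sets_FM: "sets (FM d q p) = sets (\<Pi>\<^sub>M i\<in>vertices d \<times> UNIV. count_space UNIV)"
  unfolding FM_def by (intro sets_PiM_cong) auto

lemma coordinate_event_measurable_FM:
  assumes "coordinate_event K P" "K \<subseteq> vertices d"
  shows "Measurable.pred (FM d q p) P"
  using coordinate_event_mono[OF assms] measurable_cong_sets[OF sets_FM refl]
  unfolding coordinate_event_def by blast

text \<open>A frog has countably many possible states, so by induction on time each state event is a
  countable combination of events on single moves. Numbering the vertices by \<open>to_nat\<close>
  expresses infinitude by countable quantifiers.\<close>

lemma recurrent_measurable: "Measurable.pred (FM d q p) (recurrent d)"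
proof -
  let ?M = "FM d q p"
  have comp: "(\<lambda>\<omega>. \<omega> (v, n)) \<in> measurable ?M (count_space UNIV)" if "v \<in> vertices d" for v n
    using that unfolding measurable_cong_sets[OF sets_FM refl]
    by (intro measurable_component_singleton) auto
  have st: "Measurable.pred ?M (\<lambda>\<omega>. frog_state d \<omega> t v = s)" if "v \<in> vertices d" for t v s
    using that
  proof (induction t arbitrary: v s)
    case (Suc t)
    have adv: "Measurable.pred ?M (\<lambda>\<omega>. advance (\<lambda>n. \<omega> (u, n)) (frog_state d \<omega> t u) = s)"
      if u: "u \<in> vertices d" for u s
    proof -
      note [measurable] = comp[OF u] Suc.IH[OF u]
      have "advance (\<lambda>n. \<omega> (u, n)) (frog_state d \<omega> t u) = s \<longleftrightarrow>
          (frog_state d \<omega> t u = Asleep \<and> s = Asleep) \<or> (frog_state d \<omega> t u = Dead \<and> s = Dead)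
          \<or> (\<exists>n. \<exists>x\<in>UNIV. frog_state d \<omega> t u = Awake n x \<and>
               (\<omega> (u, n) = Die \<and> s = Dead \<or> \<omega> (u, n) = Up \<and> s = Awake (Suc n) (tl x)
               \<or> (\<exists>c. \<omega> (u, n) = Down c \<and> s = Awake (Suc n) (c # x))))" for \<omega>
        by (cases "frog_state d \<omega> t u") (auto split: move.splits)
      then show ?thesis by simp
    qed
    have act: "Measurable.pred ?M (\<lambda>\<omega>. \<exists>u\<in>vertices d. active_at v (advance (\<lambda>n. \<omega> (u, n)) (frog_state d \<omega> t u)))"
    proof (rule measurable_pred_countable)
      fix u assume "u \<in> vertices d"
      note [measurable] = adv[OF this]
      show "Measurable.pred ?M (\<lambda>\<omega>. active_at v (advance (\<lambda>n. \<omega> (u, n)) (frog_state d \<omega> t u)))"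
        unfolding active_at_def by measurable
    qed simp
    have "frog_state d \<omega> (Suc t) v = s \<longleftrightarrow>
       (let b = advance (\<lambda>n. \<omega> (v, n)) (frog_state d \<omega> t v) = Asleep \<and>
          (\<exists>u\<in>vertices d. active_at v (advance (\<lambda>n. \<omega> (u, n)) (frog_state d \<omega> t u)))
        in b \<and> s = Awake 0 v \<or> \<not> b \<and> advance (\<lambda>n. \<omega> (v, n)) (frog_state d \<omega> t v) = s)" for \<omega>
      by (auto simp: Let_def)
    then show ?case
      unfolding Let_def by (simp only:) (intro pred_intros_logic act adv[OF Suc.prems] measurable_const; simp)
  qed simp
  have R: "Measurable.pred ?M (\<lambda>\<omega>. \<exists>t. active_at [] (frog_state d \<omega> t v))" if "v \<in> vertices d" for v
    unfolding active_at_def using st[OF that] by measurable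
  have "recurrent d \<omega> \<longleftrightarrow> (\<forall>k::nat. \<exists>v\<in>vertices d. k \<le> to_nat v \<and> (\<exists>t. active_at [] (frog_state d \<omega> t v)))" for \<omega>
  proof -
    let ?R = "{v \<in> vertices d. \<exists>t. active_at [] (frog_state d \<omega> t v)}"
    have "finite (to_nat ` ?R) \<longleftrightarrow> finite ?R"
      by (intro finite_image_iff inj_on_subset[OF inj_to_nat]) auto
    then have "recurrent d \<omega> \<longleftrightarrow> infinite (to_nat ` ?R)" by (simp add: recurrent_def)
    also have "\<dots> \<longleftrightarrow> (\<forall>k. \<exists>m\<ge>k. m \<in> to_nat ` ?R)" by (rule infinite_nat_iff_unbounded_le)
    finally show ?thesis by blast
  qed
  moreover have "Measurable.pred ?M
     (\<lambda>\<omega>. \<forall>k::nat. \<exists>v\<in>vertices d. k \<le> to_nat v \<and> (\<exists>t. active_at [] (frog_state d \<omega> t v)))"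
    by (rule pred_intros_countable, rule measurable_pred_countable, simp,
        rule pred_intros_logic, simp, erule R)
  ultimately have "Measurable.pred ?M (\<lambda>\<omega>. recurrent d \<omega>)" by (simp only:)
  then show ?thesis .
qed

section \<open>Hitting probabilities of a single walk\<close>

lemma expectation_move_pmf:
  fixes g :: "move \<Rightarrow> real"
  assumes "0 \<le> p" "p \<le> 1" "0 \<le> q" "q \<le> 1" "d > 0"
  shows "measure_pmf.expectation (move_pmf d q p) g =
    q * (p * g Up + (1 - p) / d * (\<Sum>c<d. g (Down c))) + (1 - q) * g Die"
proof -
  let ?D = "map_pmf Down (pmf_of_set {..<d})"
  let ?J = "bernoulli_pmf p \<bind> (\<lambda>up. if up then return_pmf Up else ?D)"
  have ne: "{..<d} \<noteq> {}" using assms(5) by auto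
  have "measure_pmf.expectation (move_pmf d q p) g
      = q * measure_pmf.expectation ?J g + (1 - q) * g Die"
    unfolding move_pmf_def
    by (subst pmf_expectation_bind[of UNIV]) (use ne assms in \<open>auto simp: UNIV_bool\<close>)
  moreover have "measure_pmf.expectation ?J g
      = p * g Up + (1 - p) * measure_pmf.expectation ?D g"
    by (subst pmf_expectation_bind[of UNIV]) (use ne assms in \<open>auto simp: UNIV_bool\<close>)
  moreover have "measure_pmf.expectation ?D g = (\<Sum>c<d. g (Down c)) / d"
    using ne by (simp add: integral_pmf_of_set)
  ultimately show ?thesis by simp
qed

definition stream_measure :: "nat \<Rightarrow> real \<Rightarrow> real \<Rightarrow> (nat \<Rightarrow> move) measure" where
  "stream_measure d q p = (\<Pi>\<^sub>M i\<in>UNIV. measure_pmf (move_pmf d q p))"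

lemma space_stream_measure [simp]: "space (stream_measure d q p) = UNIV"
  by (simp add: stream_measure_def space_PiM)

lemma prob_space_stream_measure: "prob_space (stream_measure d q p)"
  unfolding stream_measure_def by (intro prob_space_PiM measure_pmf.prob_space_axioms)

lemma measurable_reaches_stream [measurable]:
  "Measurable.pred (stream_measure d q p) (reaches w n x)"
proof -
  \<comment> \<open>The stream is regarded as that of the single vertex \<open>[]\<close>, so that
    \<open>measurable_reaches\<close> applies.\<close>
  have "(\<lambda>\<xi>. \<lambda>i\<in>{[]} \<times> UNIV. \<xi> (snd i)) \<in>
      measurable (stream_measure d q p) (\<Pi>\<^sub>M i\<in>{[]::vertex} \<times> UNIV. count_space UNIV)"
    unfolding stream_measure_def by measurable
  from measurable_compose[OF this measurable_reaches[of "[]" "{[]}" w n x 0]]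
  show ?thesis by simp
qed

definition reach_prob :: "nat \<Rightarrow> real \<Rightarrow> real \<Rightarrow> vertex \<Rightarrow> nat \<Rightarrow> vertex \<Rightarrow> real" where
  "reach_prob d q p w n x = measure (stream_measure d q p) {\<xi>. reaches w n x \<xi>}"

text \<open>First-step analysis: \<open>case_nat\<close> maps an independent pair of one move and
  one stream to a stream with the same law, and integrating over the first move gives the
  recursion.\<close>

lemma reach_prob_Suc:
  assumes "0 \<le> p" "p \<le> 1" "0 \<le> q" "q \<le> 1" "d > 0" "x \<noteq> w"
  shows "reach_prob d q p w (Suc n) x =
    q * (p * reach_prob d q p w n (tl x) + (1 - p) / d * (\<Sum>c<d. reach_prob d q p w n (c # x)))"
proof -
  let ?N = "measure_pmf (move_pmf d q p)" and ?S = "stream_measure d q p"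
  interpret N: prob_space ?N by (rule measure_pmf.prob_space_axioms)
  interpret seq: sequence_space ?N by unfold_locales
  interpret S: prob_space ?S by (rule prob_space_stream_measure)
  interpret NS: pair_prob_space ?N ?S ..
  have iter: "distr (?N \<Otimes>\<^sub>M ?S) ?S (\<lambda>(s, \<omega>). case_nat s \<omega>) = ?S"
    using seq.PiM_iter by (simp add: stream_measure_def)
  have [measurable]: "(\<lambda>(s, \<omega>). case_nat s \<omega>) \<in> measurable (?N \<Otimes>\<^sub>M ?S) ?S"
    unfolding stream_measure_def case_prod_unfold
  proof (rule measurable_PiM_single')
    fix i
    show "(\<lambda>\<omega>. case_nat (fst \<omega>) (snd \<omega>) i) \<in>
        measurable (?N \<Otimes>\<^sub>M PiM UNIV (\<lambda>_. ?N)) ?N"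
      by (cases i) (simp_all del: measurable_pmf_measure1 measurable_pmf_measure2)
  qed (auto simp: space_PiM)
  let ?f = "\<lambda>\<xi>. indicator {\<xi>. reaches w (Suc n) x \<xi>} \<xi> :: real"
  have [measurable]: "{\<xi>. reaches w (Suc n) x \<xi>} \<in> sets ?S"
    using measurable_reaches_stream[of w "Suc n" x d q p] by (simp add: pred_def)
  have "reach_prob d q p w (Suc n) x = (\<integral>\<xi>. ?f \<xi> \<partial>?S)"
    by (simp add: reach_prob_def)
  also have "\<dots> = (\<integral>z. ?f (case z of (s, \<omega>) \<Rightarrow> case_nat s \<omega>) \<partial>(?N \<Otimes>\<^sub>M ?S))"
    by (subst iter[symmetric], subst integral_distr) auto
  also have "\<dots> = (\<integral>s. (\<integral>\<omega>. ?f (case_nat s \<omega>) \<partial>?S) \<partial>?N)"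
    by (subst NS.integral_fst'[symmetric])
       (auto intro!: NS.integrable_const_bound[where B=1] simp: case_prod_unfold)
  also have "\<dots> = (\<integral>s. (case s of Die \<Rightarrow> 0 | Up \<Rightarrow> reach_prob d q p w n (tl x)
        | Down c \<Rightarrow> reach_prob d q p w n (c # x)) \<partial>?N)"
  proof (intro Bochner_Integration.integral_cong refl)
    fix s
    have [measurable]: "{\<xi>. reaches w n y \<xi>} \<in> sets ?S" for y
      using measurable_reaches_stream[of w n y d q p] by (simp add: pred_def)
    have "(\<integral>\<omega>. ?f (case_nat s \<omega>) \<partial>?S) = (\<integral>\<omega>. indicator {\<omega>. reaches w (Suc n) x (case_nat s \<omega>)} \<omega> \<partial>?S)"
      by (intro Bochner_Integration.integral_cong) (auto simp: indicator_def)
    also have "\<dots> = measure ?S {\<omega>. reaches w (Suc n) x (case_nat s \<omega>)}" by simp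
    also have "\<dots> = (case s of Die \<Rightarrow> 0 | Up \<Rightarrow> reach_prob d q p w n (tl x)
        | Down c \<Rightarrow> reach_prob d q p w n (c # x))"
      using assms(6) by (cases s) (auto simp: reach_prob_def)
    finally show "(\<integral>\<omega>. ?f (case_nat s \<omega>) \<partial>?S) = \<dots>" .
  qed
  also have "\<dots> = q * (p * reach_prob d q p w n (tl x) + (1 - p) / d * (\<Sum>c<d. reach_prob d q p w n (c # x)))"
    using assms by (simp add: expectation_move_pmf)
  finally show ?thesis .
qed

text \<open>
  Subtracting \<open>\<epsilon>\<close> turns the multiplicative slack \<open>\<kappa>\<close> into an additive gain \<open>\<kappa> \<epsilon>\<close> per step
  wherever \<open>F > \<epsilon>\<close>, so that after finitely many steps the trivial bound \<open>F \<le> 1\<close> is absorbed.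
\<close>

lemma reach_prob_ge:
  assumes pq: "0 \<le> p" "p \<le> 1" "0 \<le> q" "q \<le> 1" "d > 0"
    and F: "\<And>x. F x \<le> 1" and \<kappa>: "\<kappa> > 0"
    and sub: "\<And>x. x \<noteq> w \<Longrightarrow> (1 + \<kappa>) * F x \<le> q * (p * F (tl x) + (1 - p) / d * (\<Sum>c<d. F (c # x)))"
    and \<epsilon>: "\<epsilon> > 0"
  shows "F x - \<epsilon> - max 0 (1 - real n * (\<kappa> * \<epsilon>)) \<le> reach_prob d q p w n x"
proof (induction n arbitrary: x)
  case 0
  have "0 \<le> reach_prob d q p w 0 x" by (simp add: reach_prob_def)
  with F[of x] \<epsilon> show ?case by simp
next
  case (Suc n)
  let ?u = "reach_prob d q p w"
  define b where "b = max 0 (1 - real n * (\<kappa> * \<epsilon>))"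
  have b: "0 \<le> b" by (simp add: b_def)
  interpret S: prob_space "stream_measure d q p" by (rule prob_space_stream_measure)
  have nonneg: "0 \<le> ?u (Suc n) x" by (simp add: reach_prob_def)
  show ?case
  proof (cases "x = w")
    case True
    then have "?u (Suc n) x = 1"
      using S.prob_space by (simp add: reach_prob_def)
    with F[of x] \<epsilon> show ?thesis by simp
  next
    case False
    show ?thesis
    proof (cases "F x \<le> \<epsilon>")
      case True
      with nonneg show ?thesis by simp
    next
      case Fx: False
      have "q * (p * (F (tl x) - \<epsilon> - b) + (1 - p) / d * (\<Sum>c<d. F (c # x) - \<epsilon> - b)) \<le> ?u (Suc n) x"
        unfolding reach_prob_Suc[OF pq False]
        using pq Suc.IH[folded b_def] by (intro mult_left_mono add_mono sum_mono) auto
      moreover have "q * (p * (F (tl x) - \<epsilon> - b) + (1 - p) / d * (\<Sum>c<d. F (c # x) - \<epsilon> - b))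
         = q * (p * F (tl x) + (1 - p) / d * (\<Sum>c<d. F (c # x))) - q * (\<epsilon> + b)"
      proof -
        have "(1 - p) / d * (\<Sum>c<d. F (c # x) - \<epsilon> - b)
            = (1 - p) / d * (\<Sum>c<d. F (c # x)) - (1 - p) * (\<epsilon> + b)"
          using pq(5) by (simp add: sum_subtractf field_simps)
        then show ?thesis by (simp only:) (simp add: algebra_simps)
      qed
      \<comment> \<open>The subtracted constant is averaged with total weight
        \<open>q \<le> 1\<close>, so it does not grow.\<close>
      moreover have "q * (\<epsilon> + b) \<le> 1 * (\<epsilon> + b)"
        using pq \<epsilon> b by (intro mult_right_mono) auto
      moreover have "F x + \<kappa> * \<epsilon> \<le> (1 + \<kappa>) * F x"
        using Fx \<kappa> by (simp add: algebra_simps)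
      moreover note sub[OF False]
      ultimately have "F x + \<kappa> * \<epsilon> - \<epsilon> - b \<le> ?u (Suc n) x"
        by argo
      moreover have "b \<le> \<kappa> * \<epsilon> + max 0 (1 - real (Suc n) * (\<kappa> * \<epsilon>))"
        using \<kappa> \<epsilon> by (auto simp: b_def max_def algebra_simps)
      ultimately show ?thesis by linarith
    qed
  qed
qed

section \<open>Visits and independence in the frog model\<close>

abbreviation move_family :: "nat \<Rightarrow> real \<Rightarrow> real \<Rightarrow> vertex \<times> nat \<Rightarrow> move measure" where
  "move_family d q p \<equiv> (\<lambda>_. measure_pmf (move_pmf d q p))"

lemma prob_space_FM: "prob_space (FM d q p)"
  unfolding FM_def by (intro prob_space_PiM measure_pmf.prob_space_axioms)

lemma visits_measurable:
  assumes "u \<in> vertices d"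
  shows "Measurable.pred (FM d q p) (visits u w)"
  using coordinate_event_measurable_FM[OF coordinate_event_visits[of u "{u}"]] assms by auto

text \<open>The stream of one vertex is a marginal of \<open>FM d q p\<close> with law
  \<open>stream_measure d q p\<close>.\<close>

lemma reach_prob_le_visits:
  assumes "u \<in> vertices d"
  shows "reach_prob d q p w n u \<le> \<P>(\<omega> in FM d q p. visits u w \<omega>)"
proof -
  interpret M: prob_space "FM d q p" by (rule prob_space_FM)
  let ?f = "\<lambda>\<omega> i. \<omega> (u, i)"
  have "distr (FM d q p) (stream_measure d q p) (\<lambda>\<omega>. \<lambda>i\<in>UNIV. \<omega> (u, i)) = stream_measure d q p"
    unfolding FM_def stream_measure_def using assms
    by (intro distr_PiM_reindex[where f="\<lambda>i. (u, i)" and M="move_family d q p"]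
        measure_pmf.prob_space_axioms) (auto intro: inj_onI)
  then have eq: "distr (FM d q p) (stream_measure d q p) ?f = stream_measure d q p"
    by (simp add: restrict_def)
  have [measurable]: "?f \<in> measurable (FM d q p) (stream_measure d q p)"
    unfolding FM_def stream_measure_def using assms by (intro measurable_PiM_single') (auto simp: space_PiM)
  have [measurable]: "{\<xi>. reaches w n u \<xi>} \<in> sets (stream_measure d q p)"
    using measurable_reaches_stream[of w n u d q p] by (simp add: pred_def)
  note [measurable] = visits_measurable[OF assms]
  have "reach_prob d q p w n u = measure (distr (FM d q p) (stream_measure d q p) ?f) {\<xi>. reaches w n u \<xi>}"
    by (simp add: reach_prob_def eq)
  also have "\<dots> = \<P>(\<omega> in FM d q p. reaches w n u (?f \<omega>))"
    by (subst measure_distr) (auto intro!: arg_cong[where f="measure _"])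
  also have "\<dots> \<le> \<P>(\<omega> in FM d q p. visits u w \<omega>)"
    by (intro M.finite_measure_mono) (auto simp: visits_def)
  finally show ?thesis .
qed

text \<open>An \<open>n\<close> with \<open>n * (\<kappa> * \<epsilon>) > 1\<close> removes the
  \<open>max\<close> term from \<open>reach_prob_ge\<close>; then \<open>\<epsilon>\<close> is
  arbitrary.\<close>

lemma prob_visits_ge:
  assumes pq: "0 \<le> p" "p \<le> 1" "0 \<le> q" "q \<le> 1" "d > 0"
    and F: "\<And>x. F x \<le> 1" and \<kappa>: "\<kappa> > 0"
    and sub: "\<And>x. x \<noteq> w \<Longrightarrow> (1 + \<kappa>) * F x \<le> q * (p * F (tl x) + (1 - p) / d * (\<Sum>c<d. F (c # x)))"
    and u: "u \<in> vertices d"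
  shows "F u \<le> \<P>(\<omega> in FM d q p. visits u w \<omega>)"
proof (rule field_le_epsilon)
  fix \<epsilon> :: real assume \<epsilon>: "\<epsilon> > 0"
  with \<kappa> have "\<kappa> * \<epsilon> > 0" by simp
  then obtain n where "1 < real n * (\<kappa> * \<epsilon>)" using reals_Archimedean3 by blast
  with reach_prob_ge[where F=F and x=u and n=n and w=w, OF pq F \<kappa> sub \<epsilon>] reach_prob_le_visits[where n=n and w=w and q=q and p=p, OF u]
  show "F u \<le> \<P>(\<omega> in FM d q p. visits u w \<omega>) + \<epsilon>" by simp
qed

text \<open>Both events are preimages under restrictions to disjoint blocks of coordinates, and such
  restrictions are independent under a product measure.\<close>

lemma coordinate_events_independent:
  assumes P: "coordinate_event K P" and Q: "coordinate_event L Q"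
    and KL: "K \<subseteq> vertices d" "L \<subseteq> vertices d" "K \<inter> L = {}"
  shows "\<P>(\<omega> in FM d q p. P \<omega> \<and> Q \<omega>) = \<P>(\<omega> in FM d q p. P \<omega>) * \<P>(\<omega> in FM d q p. Q \<omega>)"
proof -
  let ?M = "FM d q p" and ?I = "vertices d \<times> (UNIV::nat set)"
  interpret M: prob_space ?M by (rule prob_space_FM)
  have ne: "?I \<noteq> {}" by (auto simp: vertices_def intro: exI[of _ "[]"])
  have rv: "(\<lambda>\<omega>. \<omega> i) \<in> measurable ?M (move_family d q p i)" if "i \<in> ?I" for i
    unfolding FM_def using that by (rule measurable_component_singleton)
  \<comment> \<open>The joint law of all coordinates is the product of their laws, which is the
    criterion for their independence.\<close>
  have "distr ?M (PiM ?I (move_family d q p)) (\<lambda>\<omega>. \<lambda>i\<in>?I. \<omega> i) = distr ?M ?M (\<lambda>\<omega>. \<omega>)"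
    by (intro distr_cong) (auto simp: FM_def space_PiM PiE_restrict)
  also have "\<dots> = ?M" by (rule distr_id)
  also have "\<dots> = (\<Pi>\<^sub>M i\<in>?I. distr ?M (move_family d q p i) (\<lambda>\<omega>. \<omega> i))"
    unfolding FM_def
    by (intro PiM_cong refl distr_PiM_component[symmetric] measure_pmf.prob_space_axioms)
  finally have "M.indep_vars (move_family d q p) (\<lambda>i \<omega>. \<omega> i) ?I"
    by (subst M.indep_vars_iff_distr_eq_PiM'[OF ne rv]) auto
  then have "M.indep_var
      (PiM (K \<times> UNIV) (move_family d q p)) (\<lambda>\<omega>. restrict (\<lambda>i. \<omega> i) (K \<times> UNIV))
      (PiM (L \<times> UNIV) (move_family d q p)) (\<lambda>\<omega>. restrict (\<lambda>i. \<omega> i) (L \<times> UNIV))"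
    by (rule M.indep_var_restrict) (use KL in auto)
  from M.indep_varD[OF this] have prod:
    "M.prob ((\<lambda>\<omega>. (restrict \<omega> (K \<times> UNIV), restrict \<omega> (L \<times> UNIV))) -` (A \<times> B) \<inter> space ?M)
      = M.prob ((\<lambda>\<omega>. restrict \<omega> (K \<times> UNIV)) -` A \<inter> space ?M)
        * M.prob ((\<lambda>\<omega>. restrict \<omega> (L \<times> UNIV)) -` B \<inter> space ?M)"
    if "A \<in> sets (PiM (K \<times> UNIV) (move_family d q p))"
       "B \<in> sets (PiM (L \<times> UNIV) (move_family d q p))" for A B
    using that by blast
  have sets_eq: "sets (PiM (J \<times> UNIV) (move_family d q p))
      = sets (\<Pi>\<^sub>M i\<in>J \<times> (UNIV::nat set). count_space UNIV)" for J
    by (intro sets_PiM_cong) auto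
  have event: "{\<eta> \<in> J \<times> UNIV \<rightarrow>\<^sub>E UNIV. R \<eta>} \<in> sets (PiM (J \<times> UNIV) (move_family d q p))"
      and restrict: "R (restrict \<omega> (J \<times> UNIV)) = R \<omega>"
    if "coordinate_event J R" for J R \<omega>
    using that by (simp_all add: coordinate_event_def pred_def sets_eq space_PiM)
  have "{\<omega> \<in> space ?M. P \<omega> \<and> Q \<omega>} =
      (\<lambda>\<omega>. (restrict \<omega> (K \<times> UNIV), restrict \<omega> (L \<times> UNIV))) -`
      ({\<eta> \<in> K \<times> UNIV \<rightarrow>\<^sub>E UNIV. P \<eta>} \<times> {\<eta> \<in> L \<times> UNIV \<rightarrow>\<^sub>E UNIV. Q \<eta>}) \<inter> space ?M"
    "{\<omega> \<in> space ?M. P \<omega>} = (\<lambda>\<omega>. restrict \<omega> (K \<times> UNIV)) -` {\<eta> \<in> K \<times> UNIV \<rightarrow>\<^sub>E UNIV. P \<eta>} \<inter> space ?M"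
    "{\<omega> \<in> space ?M. Q \<omega>} = (\<lambda>\<omega>. restrict \<omega> (L \<times> UNIV)) -` {\<eta> \<in> L \<times> UNIV \<rightarrow>\<^sub>E UNIV. Q \<eta>} \<inter> space ?M"
    using restrict[OF P] restrict[OF Q] by auto
  then show ?thesis
    by (simp only: prod[OF event[OF P] event[OF Q]])
qed

section \<open>Path weights as lower bounds for visiting probabilities\<close>

text \<open>
  The walk from \<open>x\<close> to \<open>w\<close> first climbs to their last common ancestor, with factor \<open>\<alpha>\<close> per step,
  and then descends, with factor \<open>\<eta>\<close> per step.
\<close>

fun path_weight :: "real \<Rightarrow> real \<Rightarrow> vertex \<Rightarrow> vertex \<Rightarrow> real" where
  "path_weight \<alpha> \<eta> w [] = \<eta> ^ length w"
| "path_weight \<alpha> \<eta> w (c # x) =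
     (if suffix (c # x) w then \<eta> ^ (length w - length (c # x)) else \<alpha> * path_weight \<alpha> \<eta> w x)"

lemma path_weight_suffix:
  "suffix x w \<Longrightarrow> path_weight \<alpha> \<eta> w x = \<eta> ^ (length w - length x)"
  by (cases x) auto

lemma path_weight_bounds:
  assumes "0 \<le> \<alpha>" "\<alpha> \<le> 1" "0 \<le> \<eta>" "\<eta> \<le> 1"
  shows "0 \<le> path_weight \<alpha> \<eta> w x \<and> path_weight \<alpha> \<eta> w x \<le> 1"
  using assms by (induction x) (auto simp: power_le_one intro: mult_le_one)

lemma path_weight_root: "path_weight \<alpha> \<eta> [] x = \<alpha> ^ length x"
  by (induction x) auto

text \<open>If \<open>x\<close> is an ancestor of \<open>w\<close>, then \<open>down\<close>
  applies: one child leads towards \<open>w\<close> and gains a factor \<open>1 / \<eta>\<close>,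
  while the other \<open>d - 1\<close> children lose a factor \<open>\<alpha>\<close>. Otherwise
  \<open>up\<close> applies: the parent gains a factor \<open>1 / \<alpha>\<close> and every child
  loses a factor \<open>\<alpha>\<close>.\<close>

lemma path_weight_subharmonic:
  assumes pq: "0 \<le> p" "p \<le> 1" "0 \<le> q" "q \<le> 1" "d > 0"
    and \<alpha>: "0 \<le> \<alpha>" "\<alpha> \<le> 1" and \<eta>: "0 \<le> \<eta>" "\<eta> \<le> 1"
    and up: "(1 + \<kappa>) * \<alpha> \<le> q * (p + (1 - p) * \<alpha>\<^sup>2)"
    and down: "(1 + \<kappa>) * \<eta> \<le> q * (p * \<eta>\<^sup>2 + (1 - p) / d * (1 + (real d - 1) * \<alpha> * \<eta>))"
    and w: "w \<in> vertices d" "x \<noteq> w"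
  shows "(1 + \<kappa>) * path_weight \<alpha> \<eta> w x \<le> q * (p * path_weight \<alpha> \<eta> w (tl x)
           + (1 - p) / d * (\<Sum>c<d. path_weight \<alpha> \<eta> w (c # x)))"
proof (cases "suffix x w")
  case True
  let ?W = "path_weight \<alpha> \<eta> w"
  from True obtain zs where zs: "w = zs @ x" by (auto simp: suffix_def)
  with w have "zs \<noteq> []" by auto
  then obtain ys c where "zs = ys @ [c]" by (metis rev_exhaust)
  with zs have wc: "w = ys @ c # x" by simp
  with w have c: "c < d" by (auto simp: vertices_def)
  define k where "k = length ys"
  have Wx: "?W x = \<eta> * \<eta> ^ k"
    using True by (simp add: path_weight_suffix wc k_def)
  have Wc: "?W (c # x) = \<eta> ^ k"
    by (subst path_weight_suffix) (auto simp: suffix_def wc k_def)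
  have Wc': "?W (c' # x) = \<alpha> * ?W x" if "c' \<noteq> c" for c'
    using that wc by (auto simp: suffix_def)
  have tl: "\<eta>\<^sup>2 * \<eta> ^ k \<le> ?W (tl x)"
  proof (cases x)
    case Nil
    \<comment> \<open>\<open>Up\<close> leaves a frog at the root in place, so the weight stays
      \<open>\<eta> * \<eta> ^ k\<close>, which is no smaller as
      \<open>\<eta> \<le> 1\<close>.\<close>
    have "\<eta> * (\<eta> * \<eta> ^ k) \<le> 1 * (\<eta> * \<eta> ^ k)" using \<eta> by (intro mult_right_mono) auto
    with Nil Wx show ?thesis by (simp add: power2_eq_square mult.assoc)
  next
    case (Cons a x')
    then have "suffix x' w" by (auto simp: wc suffix_def)
    with Cons show ?thesis by (simp add: path_weight_suffix wc k_def power2_eq_square)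
  qed
  have "(\<Sum>c'<d. ?W (c' # x)) = ?W (c # x) + (\<Sum>c'\<in>{..<d} - {c}. ?W (c' # x))"
    using c by (subst sum.remove[of _ c]) auto
  also have "(\<Sum>c'\<in>{..<d} - {c}. ?W (c' # x)) = (\<Sum>c'\<in>{..<d} - {c}. \<alpha> * ?W x)"
    by (intro sum.cong Wc') auto
  also have "\<dots> = (real d - 1) * \<alpha> * ?W x"
    using c by (simp add: of_nat_diff)
  finally have children: "(\<Sum>c'<d. ?W (c' # x)) = (1 + (real d - 1) * \<alpha> * \<eta>) * \<eta> ^ k"
    unfolding Wc Wx by (simp add: algebra_simps)
  have "(1 + \<kappa>) * ?W x = ((1 + \<kappa>) * \<eta>) * \<eta> ^ k" by (simp add: Wx)
  also have "\<dots> \<le> q * (p * \<eta>\<^sup>2 + (1 - p) / d * (1 + (real d - 1) * \<alpha> * \<eta>)) * \<eta> ^ k"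
    using down \<eta> by (intro mult_right_mono) auto
  also have "\<dots> = q * (p * (\<eta>\<^sup>2 * \<eta> ^ k) + (1 - p) / d * ((1 + (real d - 1) * \<alpha> * \<eta>) * \<eta> ^ k))"
    by (simp add: algebra_simps)
  also have "\<dots> \<le> q * (p * ?W (tl x) + (1 - p) / d * (\<Sum>c<d. ?W (c # x)))"
    unfolding children using tl pq by (intro mult_left_mono add_mono order.refl) auto
  finally show ?thesis .
next
  case False
  let ?W = "path_weight \<alpha> \<eta> w"
  from False obtain a x' where x: "x = a # x'" by (cases x) auto
  with False have Wx: "?W x = \<alpha> * ?W x'" by simp
  have "\<not> suffix (c # x) w" for c
    using False by (auto simp: suffix_def)
  then have children: "(\<Sum>c<d. ?W (c # x)) = real d * (\<alpha> * ?W x)"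
    by simp
  have "(1 + \<kappa>) * ?W x = ((1 + \<kappa>) * \<alpha>) * ?W x'" by (simp add: Wx)
  also have "\<dots> \<le> q * ((p + (1 - p) * \<alpha>\<^sup>2) * ?W x')"
    unfolding mult.assoc[of q, symmetric]
    using up path_weight_bounds[OF \<alpha> \<eta>, of w x'] by (intro mult_right_mono) auto
  also have "(p + (1 - p) * \<alpha>\<^sup>2) * ?W x' = p * ?W x' + (1 - p) / d * (real d * (\<alpha> * ?W x))"
    unfolding Wx using pq(5) by (simp add: distrib_right power2_eq_square mult.assoc)
  also have "p * ?W x' + (1 - p) / d * (real d * (\<alpha> * ?W x))
      = p * ?W (tl x) + (1 - p) / d * (\<Sum>c<d. ?W (c # x))"
    unfolding children by (simp only: x list.sel)
  finally show ?thesis .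
qed

section \<open>The branching process of wakings\<close>

text \<open>Pairs are counted in both orders, which is weaker than the usual second-order bound but
  needs no ordering of \<open>I\<close>.\<close>

lemma (in prob_space) bonferroni:
  assumes "finite I" "\<And>i. i \<in> I \<Longrightarrow> A i \<in> events"
  shows "(\<Sum>i\<in>I. prob (A i)) - (\<Sum>i\<in>I. \<Sum>j\<in>I - {i}. prob (A i \<inter> A j)) \<le> prob (\<Union>i\<in>I. A i)"
  using assms
proof (induction I)
  case (insert k I)
  have A: "A i \<in> events" if "i \<in> insert k I" for i using insert.prems that by blast
  \<comment> \<open>The pairs \<open>(i, k)\<close> are given away here; the pairs
    \<open>(k, i)\<close> pay for the overlap of \<open>A k\<close> with the other events.\<close>
  have "(\<Sum>i\<in>I. \<Sum>j\<in>I - {i}. prob (A i \<inter> A j)) \<le> (\<Sum>i\<in>I. \<Sum>j\<in>insert k I - {i}. prob (A i \<inter> A j))"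
    using insert.hyps by (intro sum_mono sum_mono2) auto
  moreover have "insert k I - {k} = I" using insert.hyps by auto
  ultimately have
    "(\<Sum>i\<in>I. \<Sum>j\<in>I - {i}. prob (A i \<inter> A j)) + (\<Sum>i\<in>I. prob (A k \<inter> A i))
      \<le> (\<Sum>i\<in>insert k I. \<Sum>j\<in>insert k I - {i}. prob (A i \<inter> A j))"
    using insert.hyps by simp
  moreover have "prob (\<Union>i\<in>insert k I. A i) = prob (A k) + prob (\<Union>i\<in>I. A i) - prob (A k \<inter> (\<Union>i\<in>I. A i))"
    using measure_Un3[of "A k" M "\<Union>i\<in>I. A i"] A insert.hyps by (simp add: fmeasurable_eq_sets sets.finite_UN)
  moreover have "prob (A k \<inter> (\<Union>i\<in>I. A i)) \<le> (\<Sum>i\<in>I. prob (A k \<inter> A i))"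
    unfolding Int_UN_distrib using insert.hyps A
    by (intro finite_measure_subadditive_finite) (auto intro!: sets.Int)
  moreover have "(\<Sum>i\<in>I. prob (A i)) - (\<Sum>i\<in>I. \<Sum>j\<in>I - {i}. prob (A i \<inter> A j)) \<le> prob (\<Union>i\<in>I. A i)"
    using A by (intro insert.IH) blast
  moreover have "(\<Sum>i\<in>insert k I. prob (A i)) = prob (A k) + (\<Sum>i\<in>I. prob (A i))"
    using insert.hyps by simp
  ultimately show ?case by linarith
qed simp

text \<open>\<open>\<alpha>\<close> and \<open>\<eta>\<close> are the weights of a step up and a
  step down, and \<open>\<kappa>\<close> is the slack. The conditions \<open>up\<close> and
  \<open>down\<close> are those under which path weights grow in mean by the factor
  \<open>1 + \<kappa>\<close>.\<close>

locale frog_model =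
  fixes d :: nat and q p \<alpha> \<eta> \<kappa> :: real
  assumes pq: "0 \<le> p" "p \<le> 1" "0 \<le> q" "q \<le> 1" "d > 0"
    and \<alpha>: "0 < \<alpha>" "\<alpha> \<le> 1" and \<eta>: "0 < \<eta>" "\<eta> \<le> 1" and \<kappa>: "\<kappa> > 0"
    and up: "(1 + \<kappa>) * \<alpha> \<le> q * (p + (1 - p) * \<alpha>\<^sup>2)"
    and down: "(1 + \<kappa>) * \<eta> \<le> q * (p * \<eta>\<^sup>2 + (1 - p) / d * (1 + (real d - 1) * \<alpha> * \<eta>))"
begin

sublocale prob_space "FM d q p" by (rule prob_space_FM)

lemma prob_visits_ge_path_weight:
  assumes "u \<in> vertices d" "w \<in> vertices d"
  shows "path_weight \<alpha> \<eta> w u \<le> \<P>(\<omega> in FM d q p. visits u w \<omega>)"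
proof (rule prob_visits_ge[OF pq _ \<kappa> _ assms(1)])
  show "path_weight \<alpha> \<eta> w x \<le> 1" for x
    using path_weight_bounds[of \<alpha> \<eta> w x] \<alpha> \<eta> by simp
  show "(1 + \<kappa>) * path_weight \<alpha> \<eta> w x \<le> q * (p * path_weight \<alpha> \<eta> w (tl x)
      + (1 - p) / d * (\<Sum>c<d. path_weight \<alpha> \<eta> w (c # x)))" if "x \<noteq> w" for x
    using pq \<alpha> \<eta> up down assms(2) that by (intro path_weight_subharmonic) auto
qed

definition edge :: "vertex \<Rightarrow> nat \<times> nat \<Rightarrow> (vertex \<times> nat \<Rightarrow> move) \<Rightarrow> bool" where
  "edge x = (\<lambda>(a, b) \<omega>. visits x (b # a # x) \<omega> \<or> visits x (a # x) \<omega> \<and> visits (a # x) (b # a # x) \<omega>)"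

lemma coordinate_event_edge: "coordinate_event {x, fst i # x} (edge x i)"
  unfolding edge_def case_prod_unfold
  by (intro coordinate_event_disj coordinate_event_conj coordinate_event_visits) auto

text \<open>Let A and S be the probabilities that the frog of \<open>x\<close> visits
  \<open>a # x\<close> and \<open>b # a # x\<close>. Direct visits contribute S. Visits to
  \<open>a # x\<close> but not to \<open>b # a # x\<close>, followed by an independent visit of the
  second frog, contribute at least \<open>(A - S) * \<eta>\<close>. The sum is increasing in A and
  S, where A is at least \<open>\<eta>\<close> and S at least \<open>\<eta>\<^sup>2\<close>.\<close>

lemma prob_edge_ge:
  assumes "x \<in> vertices d" "i \<in> {..<d} \<times> {..<d}"
  shows "\<eta>\<^sup>2 * (2 - \<eta>) \<le> \<P>(\<omega> in FM d q p. edge x i \<omega>)"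
proof -
  obtain a b where i: "i = (a, b)" by (cases i)
  let ?y = "a # x" and ?z = "b # a # x"
  have V: "?y \<in> vertices d" "?z \<in> vertices d"
    using assms i by (auto simp: Cons_in_vertices)
  note [measurable] = visits_measurable[OF assms(1)] visits_measurable[OF V(1)]
  let ?A = "{\<omega> \<in> space (FM d q p). visits x ?y \<omega>}"
  let ?S = "{\<omega> \<in> space (FM d q p). visits x ?z \<omega>}"
  let ?C = "{\<omega> \<in> space (FM d q p). visits ?y ?z \<omega>}"
  have A: "\<eta> \<le> prob ?A" and S: "\<eta>\<^sup>2 \<le> prob ?S" and C: "\<eta> \<le> prob ?C"
    using prob_visits_ge_path_weight[OF assms(1) V(1)] prob_visits_ge_path_weight[OF assms(1) V(2)]
      prob_visits_ge_path_weight[OF V]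
    by (simp_all add: path_weight_suffix suffix_def power2_eq_square)
  \<comment> \<open>Excluding \<open>?z\<close> makes the two ways of waking disjoint, and the event
    still depends on the stream of \<open>x\<close> only.\<close>
  have "coordinate_event {x} (\<lambda>\<omega>. visits x ?y \<omega> \<and> \<not> visits x ?z \<omega>)"
    using coordinate_event_visits[of x "{x}" ?y] coordinate_event_visits[of x "{x}" ?z]
    by (auto simp: coordinate_event_def)
  from coordinate_events_independent[OF this coordinate_event_visits[of ?y "{?y}" ?z], of d q p] assms V
  have ind: "\<P>(\<omega> in FM d q p. (visits x ?y \<omega> \<and> \<not> visits x ?z \<omega>) \<and> visits ?y ?z \<omega>)
      = \<P>(\<omega> in FM d q p. visits x ?y \<omega> \<and> \<not> visits x ?z \<omega>) * prob ?C"
    by simp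
  have diff: "prob ?A - prob ?S \<le> \<P>(\<omega> in FM d q p. visits x ?y \<omega> \<and> \<not> visits x ?z \<omega>)"
  proof -
    have "prob ?A \<le> prob ({\<omega> \<in> space (FM d q p). visits x ?y \<omega> \<and> \<not> visits x ?z \<omega>} \<union> ?S)"
      by (intro finite_measure_mono) auto
    also have "\<dots> \<le> \<P>(\<omega> in FM d q p. visits x ?y \<omega> \<and> \<not> visits x ?z \<omega>) + prob ?S"
      by (intro measure_Un_le) auto
    finally show ?thesis by simp
  qed
  have "\<eta>\<^sup>2 * (2 - \<eta>) = \<eta>\<^sup>2 * (1 - \<eta>) + \<eta> * \<eta>"
    by (simp add: power2_eq_square algebra_simps)
  also have "\<dots> \<le> prob ?S * (1 - \<eta>) + prob ?A * \<eta>"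
    using A S \<eta> by (intro add_mono mult_right_mono) auto
  also have "\<dots> = prob ?S + (prob ?A - prob ?S) * \<eta>" by (simp add: algebra_simps)
  also have "\<dots> \<le> prob ?S + \<P>(\<omega> in FM d q p. visits x ?y \<omega> \<and> \<not> visits x ?z \<omega>) * prob ?C"
    using diff C \<eta> by (intro add_left_mono order.trans[OF mult_right_mono mult_left_mono]) auto
  also have "\<dots> = prob (?S \<union> {\<omega> \<in> space (FM d q p). (visits x ?y \<omega> \<and> \<not> visits x ?z \<omega>) \<and> visits ?y ?z \<omega>})"
    unfolding ind[symmetric] by (intro finite_measure_Union[symmetric]) auto
  also have "\<dots> \<le> \<P>(\<omega> in FM d q p. edge x i \<omega>)"
    by (intro finite_measure_mono) (auto simp: edge_def i)
  finally show ?thesis .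
qed

text \<open>If some grandchild has return probability above the threshold \<open>s\<close>, its edge
  alone gives the first term of the minimum. Otherwise all of them are at most \<open>s\<close>, so
  the pair terms in \<open>bonferroni\<close> cost at most \<open>(real d)\<^sup>2 * s\<close> times
  the sum of these probabilities. The mean number of children is then only slightly reduced when
  \<open>s\<close> is small.\<close>

lemma prob_returns_Suc_ge:
  assumes x: "x \<in> vertices d" and t: "0 \<le> t" and s: "0 \<le> s"
    and ge: "\<And>a b. a < d \<Longrightarrow> b < d \<Longrightarrow> t \<le> \<P>(\<omega> in FM d q p. returns d n (b # a # x) \<omega>)"
    and small: "(real d)\<^sup>2 * s \<le> \<eta>\<^sup>2 * (2 - \<eta>)"
  shows "min (\<eta>\<^sup>2 * (2 - \<eta>) * s) ((real d)\<^sup>2 * (\<eta>\<^sup>2 * (2 - \<eta>) - (real d)\<^sup>2 * s) * t)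
    \<le> \<P>(\<omega> in FM d q p. returns d (Suc n) x \<omega>)"
proof -
  let ?M = "FM d q p" and ?I = "{..<d} \<times> {..<d}" and ?e = "\<eta>\<^sup>2 * (2 - \<eta>)"
  define T where "T = (\<lambda>(a, b). {v \<in> vertices d. suffix (b # a # x) v})"
  define R where "R = (\<lambda>(a, b). returns d n (b # a # x))"
  have TV: "T i \<subseteq> vertices d" for i by (auto simp: T_def split: prod.splits)
  have V: "b # a # x \<in> vertices d" "a # x \<in> vertices d" if "a < d" "b < d" for a b
    using that x by (auto simp: Cons_in_vertices)
  have R: "coordinate_event (T i) (R i)" if "i \<in> ?I" for i
    using that V by (auto simp: T_def R_def intro!: coordinate_event_returns)
  \<comment> \<open>Two different words of equal length are never suffixes of the same word.\<close>
  have disj: "T i \<inter> T j = {}" if "i \<noteq> j" for i j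
    using that by (cases i; cases j) (auto simp: T_def suffix_def append_eq_append_conv2 Cons_eq_append_conv)
  have edge_disj: "{x, fst i # x} \<inter> T i = {}" for i
    by (cases i) (auto simp: T_def suffix_def)
  have edge_sub: "{x, fst i # x} \<subseteq> vertices d" if "i \<in> ?I" for i
    using that x by (auto simp: Cons_in_vertices)
  define u where "u i = \<P>(\<omega> in ?M. R i \<omega>)" for i
  have u: "t \<le> u i" if "i \<in> ?I" for i
    using that ge by (auto simp: u_def R_def)
  define A where "A i = {\<omega> \<in> space ?M. edge x i \<omega> \<and> R i \<omega>}" for i
  have meas: "Measurable.pred ?M (edge x i)" "Measurable.pred ?M (R i)" if "i \<in> ?I" for i
    using coordinate_event_measurable_FM[OF coordinate_event_edge edge_sub[OF that]]
      coordinate_event_measurable_FM[OF R TV] that by auto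
  have A: "A i \<in> events" if "i \<in> ?I" for i
    using meas[OF that] unfolding A_def by measurable
  have probA: "?e * u i \<le> prob (A i)" if "i \<in> ?I" for i
  proof -
    have "prob (A i) = \<P>(\<omega> in ?M. edge x i \<omega>) * u i"
      unfolding A_def u_def
      by (rule coordinate_events_independent[OF coordinate_event_edge R]) (use that edge_sub edge_disj TV in auto)
    with prob_edge_ge[OF x that] show ?thesis by (simp add: u_def mult_right_mono)
  qed
  have probAA: "prob (A i \<inter> A j) \<le> u i * u j" if "i \<in> ?I" "j \<in> ?I" "i \<noteq> j" for i j
  proof -
    note [measurable] = meas[OF that(1)] meas[OF that(2)]
    \<comment> \<open>All edges out of \<open>x\<close> share its stream; they are dropped, and only
      the independent returns from disjoint subtrees are kept.\<close>
    have "prob (A i \<inter> A j) \<le> \<P>(\<omega> in ?M. R i \<omega> \<and> R j \<omega>)"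
      by (intro finite_measure_mono) (auto simp: A_def)
    also have "\<dots> = u i * u j"
      unfolding u_def by (rule coordinate_events_independent[OF R R]) (use that TV disj in auto)
    finally show ?thesis .
  qed
  have returns: "{\<omega> \<in> space ?M. returns d (Suc n) x \<omega>} = (\<Union>i\<in>?I. A i)"
  proof -
    have "returns d (Suc n) x \<omega> \<longleftrightarrow> (\<exists>i\<in>?I. edge x i \<omega> \<and> R i \<omega>)" for \<omega>
      unfolding returns.simps edge_def R_def case_prod_unfold ..
    then show ?thesis unfolding A_def by blast
  qed
  show ?thesis
  proof (cases "\<exists>i\<in>?I. s < u i")
    case True
    then obtain i where i: "i \<in> ?I" "s < u i" by blast
    have "?e * s \<le> ?e * u i" using i \<eta> by (intro mult_left_mono) auto
    also have "\<dots> \<le> prob (A i)" by (rule probA[OF i(1)])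
    also have "\<dots> \<le> prob (\<Union>i\<in>?I. A i)" using i A by (intro finite_measure_mono) auto
    finally show ?thesis unfolding returns by simp
  next
    case False
    have row: "(\<Sum>j\<in>?I - {i}. prob (A i \<inter> A j)) \<le> (real d)\<^sup>2 * s * u i" if "i \<in> ?I" for i
    proof -
      have "(\<Sum>j\<in>?I - {i}. prob (A i \<inter> A j)) \<le> (\<Sum>j\<in>?I - {i}. u i * s)"
      proof (rule sum_mono)
        fix j assume j: "j \<in> ?I - {i}"
        have "prob (A i \<inter> A j) \<le> u i * u j" using probAA that j by auto
        also have "\<dots> \<le> u i * s" using False j by (intro mult_left_mono) (auto simp: u_def not_less)
        finally show "prob (A i \<inter> A j) \<le> u i * s" .
      qed
      also have "\<dots> \<le> (\<Sum>j\<in>?I. u i * s)"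
        using s by (intro sum_mono2) (auto simp: u_def)
      also have "\<dots> = (real d)\<^sup>2 * s * u i" by (simp add: power2_eq_square)
      finally show ?thesis .
    qed
    have "(real d)\<^sup>2 * (?e - (real d)\<^sup>2 * s) * t = (\<Sum>i\<in>?I. (?e - (real d)\<^sup>2 * s) * t)"
      by (simp add: power2_eq_square)
    also have "\<dots> \<le> (\<Sum>i\<in>?I. (?e - (real d)\<^sup>2 * s) * u i)"
      using small u by (intro sum_mono mult_left_mono) auto
    also have "\<dots> = (\<Sum>i\<in>?I. ?e * u i) - (\<Sum>i\<in>?I. (real d)\<^sup>2 * s * u i)"
      by (simp add: left_diff_distrib sum_subtractf)
    also have "\<dots> \<le> (\<Sum>i\<in>?I. prob (A i)) - (\<Sum>i\<in>?I. \<Sum>j\<in>?I - {i}. prob (A i \<inter> A j))"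
      by (intro diff_mono sum_mono probA row)
    also have "\<dots> \<le> prob (\<Union>i\<in>?I. A i)"
      by (intro bonferroni A) auto
    finally show ?thesis unfolding returns by simp
  qed
qed

lemma prob_returns_ge:
  assumes "x \<in> vertices d" and s: "0 \<le> s" and small: "(real d)\<^sup>2 * s \<le> \<eta>\<^sup>2 * (2 - \<eta>)"
  defines "m \<equiv> (real d)\<^sup>2 * (\<eta>\<^sup>2 * (2 - \<eta>) - (real d)\<^sup>2 * s)"
  assumes m: "m \<ge> 1"
  shows "min (\<eta>\<^sup>2 * (2 - \<eta>) * s) (m ^ n * \<alpha> ^ (length x + 2 * n)) \<le> \<P>(\<omega> in FM d q p. returns d n x \<omega>)"
  using assms(1)
proof (induction n arbitrary: x)
  case 0
  have "[] \<in> vertices d" by (simp add: vertices_def)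
  from prob_visits_ge_path_weight[OF 0 this] show ?case
    by (simp add: path_weight_root min.coboundedI2)
next
  case (Suc n)
  let ?c = "\<eta>\<^sup>2 * (2 - \<eta>) * s"
  \<comment> \<open>A grandchild is two levels deeper but has one generation fewer to go, so the
    exponent of \<open>\<alpha>\<close> is the same as in the goal.\<close>
  define r where "r = m ^ n * \<alpha> ^ (length x + 2 * Suc n)"
  have c: "0 \<le> ?c" using \<eta> s by simp
  have r: "0 \<le> r" using \<alpha> m by (simp add: r_def)
  have IH: "min ?c r \<le> \<P>(\<omega> in FM d q p. returns d n (b # a # x) \<omega>)" if "a < d" "b < d" for a b
    using Suc.IH[of "b # a # x"] Suc.prems that by (simp add: Cons_in_vertices r_def)
  have "min ?c (m * min ?c r) \<le> \<P>(\<omega> in FM d q p. returns d (Suc n) x \<omega>)"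
    unfolding m_def using c r by (intro prob_returns_Suc_ge Suc.prems IH s small) auto
  \<comment> \<open>As \<open>m \<ge> 1\<close>, a bound that has reached the cap \<open>?c\<close>
    stays there.\<close>
  moreover have "min ?c r \<le> m * min ?c r" "?c \<le> m * ?c"
    using m c r by (auto intro: mult_right_mono[of 1 m, simplified])
  then have "min ?c (m * r) \<le> min ?c (m * min ?c r)"
    by (auto simp: min_def)
  ultimately show ?case by (simp add: r_def mult.assoc)
qed

text \<open>When the growth in numbers balances the longer way back to the root, every generation
  returns with probability at least \<open>c\<close>. By continuity from above, infinitely many
  generations return with probability at least \<open>c\<close>.\<close>

theorem recurrent_with_positive_probability:
  assumes growth: "1 < (real d)\<^sup>2 * (\<eta>\<^sup>2 * (2 - \<eta>)) * \<alpha>\<^sup>2"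
  shows "\<P>(\<omega> in FM d q p. recurrent d \<omega>) > 0"
proof -
  let ?M = "FM d q p" and ?e = "\<eta>\<^sup>2 * (2 - \<eta>)"
  define D where "D = (real d)\<^sup>2"
  have D: "D > 0" using pq by (simp add: D_def)
  have e: "?e > 0" using \<eta> by simp
  \<comment> \<open>Solves \<open>D * (?e - D * s) = 1 / \<alpha>\<^sup>2\<close>, which makes the
    factor per generation exactly 1; \<open>growth\<close> says that this \<open>s\<close> is
    positive.\<close>
  define s where "s = (?e - 1 / (D * \<alpha>\<^sup>2)) / D"
  have s: "s > 0" using growth D \<alpha> by (simp add: s_def field_simps flip: D_def)
  have Ds: "D * s = ?e - 1 / (D * \<alpha>\<^sup>2)" using D by (simp add: s_def)
  have m: "D * (?e - D * s) = 1 / \<alpha>\<^sup>2" unfolding Ds using D by simp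
  have small: "D * s \<le> ?e" unfolding Ds using D \<alpha> by simp
  define c where "c = min (?e * s) 1"
  have c: "c > 0" using e s by (simp add: c_def)
  have V: "[] \<in> vertices d" by (simp add: vertices_def)
  have ge: "c \<le> \<P>(\<omega> in ?M. returns d n [] \<omega>)" for n
  proof -
    have "1 \<le> 1 / \<alpha>\<^sup>2" using \<alpha> by (simp add: power_le_one)
    from prob_returns_ge[OF V, of s n, folded D_def, unfolded m, OF _ small this] s \<alpha>
    show ?thesis by (simp add: c_def power_mult power_divide)
  qed
  have meas: "Measurable.pred ?M (returns d n [])" for n
    by (rule coordinate_event_measurable_FM[OF coordinate_event_returns[OF V]]) auto
  define U where "U k = (\<Union>n\<in>{k..}. {\<omega> \<in> space ?M. returns d n [] \<omega>})" for k
  have U: "U k \<in> events" for k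
    using meas unfolding U_def by (intro sets.countable_UN') auto
  have "c \<le> prob (U k)" for k
    by (rule order.trans[OF ge[of k] finite_measure_mono[OF _ U]]) (auto simp: U_def)
  moreover have "(\<lambda>k. prob (U k)) \<longlonglongrightarrow> prob (\<Inter>k. U k)"
  proof (rule finite_Lim_measure_decseq)
    show "decseq U" unfolding decseq_def U_def by (intro allI impI UN_mono) auto
  qed (use U in auto)
  ultimately have "c \<le> prob (\<Inter>k. U k)"
    by (intro LIMSEQ_le_const) auto
  also have "\<dots> \<le> \<P>(\<omega> in ?M. recurrent d \<omega>)"
  proof (rule finite_measure_mono)
    show "(\<Inter>k. U k) \<subseteq> {\<omega> \<in> space ?M. recurrent d \<omega>}"
      unfolding U_def by (fastforce simp: INFM_nat_le intro!: recurrent_if_infinitely_many_returns)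
    show "{\<omega> \<in> space ?M. recurrent d \<omega>} \<in> events"
      using recurrent_measurable by (simp add: pred_def)
  qed
  finally show ?thesis using c by simp
qed

end

section \<open>Numerical parameters\<close>

text \<open>The right-hand side increases in \<open>p\<close> and \<open>q\<close>, so the least
  \<open>p\<close> is the worst. Without death the walk climbs a level with probability
  \<open>p / (1 - p)\<close>, here at least 0.98; the smaller weight 0.95 leaves room for the slack
  and for death.\<close>

lemma parameters_up:
  fixes p q :: real
  assumes p: "0.4950 \<le> p" and q: "0.9999998 \<le> q"
  shows "(1 + 0.0001) * 0.95 \<le> q * (p + (1 - p) * 0.95\<^sup>2)"
proof -
  have "0.9507625 \<le> 0.9025 + 0.0975 * p"
    using p by simp
  also have "\<dots> = p + (1 - p) * 0.95\<^sup>2"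
    by (simp add: power2_eq_square field_simps)
  finally have "0.9999998 * 0.9507625 \<le> q * (p + (1 - p) * 0.95\<^sup>2)"
    using q by (intro mult_mono) auto
  then show ?thesis by simp
qed

text \<open>\<open>D\<close> is the number of children and \<open>t\<close> its inverse. After
  division by \<open>t\<close> the bracket decreases in \<open>t\<close>, because
  \<open>0.855 * (1 - p) > 0.81 * p\<close> for these \<open>p\<close>; hence the binary tree, with
  \<open>t = 1 / 2\<close>, is the worst case.\<close>

lemma parameters_down:
  fixes p q t :: real
  assumes p: "0.4950 \<le> p" "p \<le> 0.4975" and q: "0.9999998 \<le> q"
    and t: "0 < t" "t \<le> 1 / 2" "D * t = 1"
  shows "(1 + 0.0001) * (0.9 * t) \<le> q * (p * (0.9 * t)\<^sup>2 + (1 - p) / D * (1 + (D - 1) * 0.95 * (0.9 * t)))"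
proof -
  have "(0.855 * (1 - p) - 0.81 * p) * t \<le> (0.855 * (1 - p) - 0.81 * p) * (1 / 2)"
    using p t by (intro mult_left_mono) auto
  also have "\<dots> = 0.4275 - 0.8325 * p"
    by (simp add: field_simps)
  also have "\<dots> \<le> 0.945 - 1.855 * p"
    using p by simp
  \<comment> \<open>0.91 exceeds the required \<open>1.0001 * 0.9 = 0.90009\<close> by enough to
    absorb \<open>q\<close>.\<close>
  finally have "0.91 \<le> 0.81 * p * t + (1 - p) * (1.855 - 0.855 * t)"
    by (simp add: field_simps)
  then have "0.9999998 * 0.91 \<le> q * (0.81 * p * t + (1 - p) * (1.855 - 0.855 * t))"
    using q by (intro mult_mono) auto
  then have "(1 + 0.0001) * 0.9 \<le> q * (0.81 * p * t + (1 - p) * (1.855 - 0.855 * t))"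
    by simp
  then have "(1 + 0.0001) * 0.9 * t \<le> q * (0.81 * p * t + (1 - p) * (1.855 - 0.855 * t)) * t"
    using t(1) by (intro mult_right_mono) auto
  moreover have "t = 1 / D"
    using t by (metis nonzero_eq_divide_eq mult.commute mult_zero_left zero_neq_one)
  then have "(1 - p) / D = (1 - p) * t" by simp
  moreover have "1 + (D - 1) * 0.95 * (0.9 * t) = 1.855 - 0.855 * t"
  proof -
    have "1 + (D - 1) * 0.95 * (0.9 * t) = 1 + 0.855 * (D * t) - 0.855 * t"
      by (simp add: field_simps)
    then show ?thesis unfolding t(3) by simp
  qed
  moreover have "q * (0.81 * p * t + (1 - p) * (1.855 - 0.855 * t)) * t
      = q * (p * (0.9 * t)\<^sup>2 + (1 - p) * t * (1.855 - 0.855 * t))"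
    by (simp add: power2_eq_square field_simps)
  ultimately show ?thesis by (simp only: mult.assoc)
qed
theorem theorem1:
  fixes d :: nat and p q :: real
  assumes "d \<ge> 2"
    and "p \<in> {0.4950..0.4975}"
    and "q \<in> {0.9999998..1}"
  shows "\<P>(\<omega> in FM d q p. recurrent d \<omega>) > 0"
proof -
  define t where "t = 1 / real d"
  have t: "0 < t" "t \<le> 1 / 2" "real d * t = 1"
    using assms(1) by (auto simp: t_def)
  have p: "0.4950 \<le> p" "p \<le> 0.4975" and q: "0.9999998 \<le> q" "q \<le> 1"
    using assms by auto
  interpret frog_model d q p "0.95" "0.9 * t" "0.0001"
  proof
    show "(1 + 0.0001) * 0.95 \<le> q * (p + (1 - p) * 0.95\<^sup>2)"
      by (rule parameters_up[OF p(1) q(1)])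
    show "(1 + 0.0001) * (0.9 * t)
        \<le> q * (p * (0.9 * t)\<^sup>2 + (1 - p) / d * (1 + (real d - 1) * 0.95 * (0.9 * t)))"
      by (rule parameters_down[OF p q(1) t])
  qed (use assms(1) p q t(1,2) in auto)
  \<comment> \<open>At \<open>t = 1 / 2\<close> the right-hand side is
    \<open>0.81 * 1.55 = 1.2555\<close>; the bound 1.25 still outweighs the loss
    \<open>0.95\<^sup>2\<close> per generation.\<close>
  have "1.25 \<le> 0.81 * (2 - 0.9 * t)" using t by simp
  also have "\<dots> = 0.81 * (real d * t)\<^sup>2 * (2 - 0.9 * t)" unfolding t(3) by simp
  also have "\<dots> = (real d)\<^sup>2 * ((0.9 * t)\<^sup>2 * (2 - 0.9 * t))"
    by (simp add: power_mult_distrib power2_eq_square)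
  finally have "1.25 * 0.95\<^sup>2 \<le> (real d)\<^sup>2 * ((0.9 * t)\<^sup>2 * (2 - 0.9 * t)) * 0.95\<^sup>2"
    by (intro mult_right_mono) auto
  moreover have "(1::real) < 1.25 * 0.95\<^sup>2" by (simp add: power2_eq_square)
  ultimately show ?thesis
    by (intro recurrent_with_positive_probability) linarith
qed

end
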